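(* Let $\Sigma: x^+=f(x,u)$ be a discrete-time system with $f:\mathcal{X}\times\mathcal{U}\to\mathcal{X}$, $\mathcal{X}\subseteq\mathbb{R}^n$, $\mathcal{U}\subseteq\mathbb{R}^m$. Let $S_{xu}=S_x\times S_u\subseteq\mathcal{X}\times\mathcal{U}$ be a constraint set, $\tilde S\subseteq S_{xu}$ a nonempty subdomain, with the state-input space equipped with the infinity norm, $\mathcal{D}$ a finite data set for $\Sigma$ with (finite) dispersion $b$ in $S_{xu}$, $\psi:\mathcal{X}\to\mathbb{R}^p$ a lifting function, and $A,\tilde A\in\mathbb{R}^{p\times p}$, $B,\tilde B\in\mathbb{R}^{p\times m}$ matrices. Let $L_\psi$ be a Lipschitz constant of $\psi$ (with respect to infinity norms) and, for $i=1,\dots,p$, let $L_{E^i_{A_i,B_i}}$ be a Lipschitz constant of $E^i_{A_i,B_i}(x,u)=\psi^i(f(x,u))-A_i\psi(x)-B_iu$. Define $\tilde{\mathcal{D}}\subseteq\mathcal{D}$ as the set of data tuples whose state-input pairs form $\tilde{\mathcal{D}}_{xu}=\mathcal{D}_{xu}\cap(\tilde S\oplus\mathcal{B}(0,b))$, and for $i=1,\dots,p$ define $$\tilde e_i(\tilde A_i,\tilde B_i)=\min_{\tilde c_i\in\mathbb{R}}\ \max_{(\bar x,\bar u,\bar x^+)\in\tilde{\mathcal{D}}}|\psi^i(\bar x^+)-\tilde A_i\psi(\bar x)-\tilde B_i\bar u-\tilde c_i|,$$ with $\tilde c_i^*$ as the minimizer. Let $$\bar\epsilon_i=\left(\|A_i^\top-\tilde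 A_i^\top\|_1L_\psi+\|B_i^\top-\tilde B_i^\top\|_1+L_{E^i_{A_i,B_i}}\right)b+\tilde e_i(\tilde A_i,\tilde B_i).$$ Then the linear system $\bar\Sigma_{lin}: z^+=\tilde Az+\tilde Bu+w$ with $w\in\bar W=\tilde c^*\oplus\prod_{i=1}^p[-\bar\epsilon_i,\bar\epsilon_i]$, where $\tilde c^*=(\tilde c_1^*,\dots,\tilde c_p^* )^\top$, is a Koopman over-approximation of $\Sigma$ (with lifting function $\psi$) over the subdomain $\tilde S$; that is, $\psi(f(x,u))-\tilde A\psi(x)-\tilde Bu\in\bar W$ for all $(x,u)\in\tilde S$.
   Context: For a matrix $M$, $M_i$ denotes its $i$-th row, and for a vector-valued function $h$, $h^i$ denotes its $i$-th component. $\|\cdot\|_1$ is the vector 1-norm and $\|\cdot\|_\infty$ the vector infinity norm. $\mathcal{B}(0,b)$ is the closed infinity-norm ball of radius $b$ in $\mathbb{R}^n\times\mathbb{R}^m$ centered at $0$, $\oplus$ is the Minkowski sum, and $\prod$ denotes the Cartesian product of intervals. A Lipschitz constant of a function $h$ is a number $L_h\ge 0$ with $\|h(y)-h(y')\|_\infty\le L_h\|y-y'\|_\infty$ for all $y,y'$ in its domain (for scalar $h$ the left-hand side is the absolute value); $\psi$ is considered on $\mathcal{X}$ and $E^i_{A_i,B_i}$ on $\mathcal{X}\times\mathcal{U}$. Data set: $\mathcal{D}=\{(x_j,u_j,x_j^+)\}_{j=1}^N$, $N\ge1$, with $(x_j,u_j)\in\mathcal{X}\times\mathcal{U}$ and $x_j^+=f(x_j,u_j)$;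 $\mathcal{D}_{xu}=\{(x_j,u_j)\}_{j=1}^N$. It is not required that $\mathcal{D}_{xu}\subseteq S_{xu}$. Dispersion: the dispersion of $\mathcal{D}$ (i.e. of $\mathcal{D}_{xu}$) in $S_{xu}$ is $b=\sup_{(x,u)\in S_{xu}}\min_{(\bar x,\bar u)\in\mathcal{D}_{xu}}\|(x,u)-(\bar x,\bar u)\|_\infty$. Koopman over-approximation: an uncertain linear system $z^+=\tilde Az+\tilde Bu+w$ with $z\in\mathbb{R}^p$, $u\in\mathcal{U}$, $w\in\bar W\subseteq\mathbb{R}^p$ is (together with $\psi$) a Koopman over-approximation of $\Sigma$ over a set $\tilde S\subseteq\mathcal{X}\times\mathcal{U}$ if $\psi(f(x,u))-\tilde A\psi(x)-\tilde Bu\in\bar W$ for all $(x,u)\in\tilde S$. *)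

theory Defs
  imports "HOL-Analysis.Analysis"
begin

text \<open>
  The library's \<^const>\<open>infnorm\<close> is the infinity norm on every Euclidean space; on
  \<open>(real ^ 'n) \<times> (real ^ 'm)\<close> it is the largest absolute value among all coordinates of both
  components, and on \<open>real\<close> it is the absolute value.
\<close>

lemma infnorm_real: "infnorm (r :: real) = \<bar>r\<bar>"
  by (simp add: infnorm_def)

lemma infnorm_pair: "infnorm (x, y) = max (infnorm x) (infnorm y)"
proof -
  have *: "(\<lambda>i. \<bar>(x, y) \<bullet> i\<bar>) ` Basis
      = (\<lambda>i. \<bar>x \<bullet> i\<bar>) ` Basis \<union> (\<lambda>i. \<bar>y \<bullet> i\<bar>) ` Basis"
    by (simp add: Basis_prod_def image_Un image_image)
  show ?thesis
    unfolding infnorm_Max * by (subst Max_Un) auto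
qed

definition infnorm_ball :: "real \<Rightarrow> 'a::euclidean_space set" where
  "infnorm_ball r = {y. infnorm y \<le> r}"

definition norm1 :: "real ^ 'n \<Rightarrow> real" where
  "norm1 v = (\<Sum>j\<in>UNIV. \<bar>v $ j\<bar>)"

definition infnorm_lipschitz_const ::
    "real \<Rightarrow> 'a::euclidean_space set \<Rightarrow> ('a \<Rightarrow> 'b::euclidean_space) \<Rightarrow> bool" where
  "infnorm_lipschitz_const L S h \<longleftrightarrow>
     0 \<le> L \<and> (\<forall>y\<in>S. \<forall>y'\<in>S. infnorm (h y - h y') \<le> L * infnorm (y - y'))"

definition data_set ::
    "(real ^ 'n) set \<Rightarrow> (real ^ 'm) set \<Rightarrow> ((real ^ 'n) \<times> (real ^ 'm) \<Rightarrow> real ^ 'n)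
      \<Rightarrow> ((real ^ 'n) \<times> (real ^ 'm) \<times> (real ^ 'n)) set \<Rightarrow> bool" where
  "data_set X U f D \<longleftrightarrow>
     finite D \<and> D \<noteq> {} \<and> (\<forall>(x, u, x')\<in>D. (x, u) \<in> X \<times> U \<and> x' = f (x, u))"

definition data_xu :: "('x \<times> 'u \<times> 'x) set \<Rightarrow> ('x \<times> 'u) set" where
  "data_xu D = (\<lambda>(x, u, x'). (x, u)) ` D"

text \<open>The supremum is taken in \<^typ>\<open>ereal\<close> so that it is \<open>\<infinity>\<close> when the distances are unbounded.\<close>

definition dispersion :: "'a::euclidean_space set \<Rightarrow> 'a set \<Rightarrow> ereal" where
  "dispersion P S = (SUP y\<in>S. ereal (Min ((\<lambda>d. infnorm (y - d)) ` P)))"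

definition local_data ::
    "((real ^ 'n) \<times> (real ^ 'm)) set \<Rightarrow> real \<Rightarrow> ((real ^ 'n) \<times> (real ^ 'm) \<times> (real ^ 'n)) set
      \<Rightarrow> ((real ^ 'n) \<times> (real ^ 'm) \<times> (real ^ 'n)) set" where
  "local_data S b D = {(x, u, x') \<in> D. (x, u) \<in> data_xu D \<inter> (S + infnorm_ball b)}"

definition lifted_error ::
    "((real ^ 'n) \<times> (real ^ 'm) \<Rightarrow> real ^ 'n) \<Rightarrow> (real ^ 'n \<Rightarrow> real ^ 'p)
      \<Rightarrow> real ^ 'p ^ 'p \<Rightarrow> real ^ 'm ^ 'p \<Rightarrow> 'p \<Rightarrow> (real ^ 'n) \<times> (real ^ 'm) \<Rightarrow> real" where
  "lifted_error f \<psi> A B i =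
     (\<lambda>(x, u). \<psi> (f (x, u)) $ i - row i A \<bullet> \<psi> x - row i B \<bullet> u)"

definition max_residual ::
    "((real ^ 'n) \<times> (real ^ 'm) \<times> (real ^ 'n)) set \<Rightarrow> (real ^ 'n \<Rightarrow> real ^ 'p)
      \<Rightarrow> real ^ 'p ^ 'p \<Rightarrow> real ^ 'm ^ 'p \<Rightarrow> 'p \<Rightarrow> real \<Rightarrow> real" where
  "max_residual D \<psi> A B i c =
     Max ((\<lambda>(x, u, x'). \<bar>\<psi> x' $ i - row i A \<bullet> \<psi> x - row i B \<bullet> u - c\<bar>) ` D)"

text \<open>
  For finite nonempty \<open>D\<close> the maximal residual has exactly one minimizer over \<open>c\<close>, namely the
  midpoint of the smallest and the largest value of
  \<open>\<psi> x' $ i - row i A \<bullet> \<psi> x - row i B \<bullet> u\<close> on \<open>D\<close>, so the minimum below is attained and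
  \<open>arg_min\<close> involves no choice.
\<close>

definition min_fit_error ::
    "((real ^ 'n) \<times> (real ^ 'm) \<times> (real ^ 'n)) set \<Rightarrow> (real ^ 'n \<Rightarrow> real ^ 'p)
      \<Rightarrow> real ^ 'p ^ 'p \<Rightarrow> real ^ 'm ^ 'p \<Rightarrow> 'p \<Rightarrow> real" where
  "min_fit_error D \<psi> A B i = (LEAST e. e \<in> range (max_residual D \<psi> A B i))"

definition opt_offset ::
    "((real ^ 'n) \<times> (real ^ 'm) \<times> (real ^ 'n)) set \<Rightarrow> (real ^ 'n \<Rightarrow> real ^ 'p)
      \<Rightarrow> real ^ 'p ^ 'p \<Rightarrow> real ^ 'm ^ 'p \<Rightarrow> 'p \<Rightarrow> real" where
  "opt_offset D \<psi> A B i = arg_min (max_residual D \<psi> A B i) (\<lambda>c. True)"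

definition koopman_over_approximation ::
    "(real ^ 'n) set \<Rightarrow> (real ^ 'm) set \<Rightarrow> ((real ^ 'n) \<times> (real ^ 'm) \<Rightarrow> real ^ 'n)
      \<Rightarrow> (real ^ 'n \<Rightarrow> real ^ 'p) \<Rightarrow> real ^ 'p ^ 'p \<Rightarrow> real ^ 'm ^ 'p \<Rightarrow> (real ^ 'p) set
      \<Rightarrow> ((real ^ 'n) \<times> (real ^ 'm)) set \<Rightarrow> bool" where
  "koopman_over_approximation X U f \<psi> A B W S \<longleftrightarrow>
     S \<subseteq> X \<times> U \<and> (\<forall>(x, u)\<in>S. \<psi> (f (x, u)) - A *v \<psi> x - B *v u \<in> W)"

end

theory Submission
  imports Defs
begin

text \<open>
  Every point of \<open>S'\<close> lies within distance \<open>b\<close> of a data point, which then belongs to the enlarged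
  subdomain. The one-step errors for \<open>(A', B')\<close> and \<open>(A, B)\<close> differ by a linear function of
  \<open>(\<psi> x, u)\<close>, so by Hoelder's inequality the former has Lipschitz constant
  \<open>norm1 (row i A - row i A') * L\<^sub>\<psi> + norm1 (row i B - row i B') + L\<^sub>E i\<close>. Moving from the data point to
  the given point therefore costs at most this constant times \<open>b\<close> on top of the residual at the
  data point, which is at most the minimal fit error when the offset is the minimizer.
\<close>

text \<open>Hoelder's inequality for the dual pair of 1-norm and infinity norm: every coordinate of
  \<open>v\<close> is at most \<open>infnorm v\<close> in absolute value.\<close>

lemma abs_inner_le_norm1_infnorm: "\<bar>a \<bullet> v\<bar> \<le> norm1 a * infnorm v"
proof -
  have "\<bar>a \<bullet> v\<bar> \<le> (\<Sum>j\<in>UNIV. \<bar>a $ j * v $ j\<bar>)"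
    by (simp add: inner_vec_def sum_abs)
  also have "\<dots> \<le> (\<Sum>j\<in>UNIV. \<bar>a $ j\<bar> * infnorm v)"
    by (intro sum_mono) (simp add: abs_mult component_le_infnorm_cart mult_left_mono)
  finally show ?thesis
    by (simp add: norm1_def sum_distrib_right)
qed

lemma norm1_nonneg: "0 \<le> norm1 v"
  by (simp add: norm1_def sum_nonneg)

lemma infnorm_lipschitz_constD:
  assumes "infnorm_lipschitz_const L S h" "y \<in> S" "y' \<in> S"
  shows "infnorm (h y - h y') \<le> L * infnorm (y - y')"
  using assms by (simp add: infnorm_lipschitz_const_def)

lemma infnorm_lipschitz_const_nonneg: "infnorm_lipschitz_const L S h \<Longrightarrow> 0 \<le> L"
  by (simp add: infnorm_lipschitz_const_def)

text \<open>The supremum bounds the distance from \<open>y\<close> to its nearest point of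
  \<open>P\<close>, and that distance is attained because \<open>P\<close> is finite and
  nonempty.\<close>

lemma dispersion_nearest:
  assumes "finite P" "P \<noteq> {}" "dispersion P S = ereal b" "y \<in> S"
  obtains d where "d \<in> P" "infnorm (y - d) \<le> b"
proof -
  let ?M = "Min ((\<lambda>d. infnorm (y - d)) ` P)"
  have "ereal ?M \<le> dispersion P S"
    unfolding dispersion_def by (rule SUP_upper) fact
  then have "?M \<le> b"
    using assms(3) by simp
  moreover have "?M \<in> (\<lambda>d. infnorm (y - d)) ` P"
    using assms(1,2) by (intro Min_in) auto
  ultimately show ?thesis
    using that by auto
qed

text \<open>The midpoint of the extreme values serves as \<open>m\<close>. For any \<open>c\<close>
  both extremes lie within \<open>?R\<close> of \<open>c\<close>, hence at most
  \<open>2 * ?R\<close> apart, while no element is farther from the midpoint than half the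
  spread.\<close>

lemma ex_minimizer_Max_abs_diff:
  fixes V :: "real set"
  assumes "finite V" "V \<noteq> {}"
  shows "\<exists>m. \<forall>c. Max ((\<lambda>v. \<bar>v - m\<bar>) ` V) \<le> Max ((\<lambda>v. \<bar>v - c\<bar>) ` V)"
proof (intro exI allI)
  fix c
  let ?m = "(Min V + Max V) / 2" and ?R = "Max ((\<lambda>v. \<bar>v - c\<bar>) ` V)"
  have R: "\<bar>v - c\<bar> \<le> ?R" if "v \<in> V" for v
    using assms that by simp
  have "\<bar>Min V - c\<bar> \<le> ?R" "\<bar>Max V - c\<bar> \<le> ?R"
    using assms by (auto intro!: R)
  then have R2: "Max V - Min V \<le> 2 * ?R"
    by linarith
  have "\<bar>v - ?m\<bar> \<le> ?R" if "v \<in> V" for v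
  proof -
    have "Min V \<le> v" "v \<le> Max V"
      using assms that by simp_all
    with R2 show ?thesis
      by (simp add: abs_le_iff field_simps)
  qed
  then show "Max ((\<lambda>v. \<bar>v - ?m\<bar>) ` V) \<le> ?R"
    using assms by simp
qed

text \<open>Both \<open>arg_min\<close> and \<open>LEAST\<close> are informative only if the minimum
  is attained. Viewing the residual as a maximum of distances from \<open>c\<close> to finitely many
  reals reduces this to the midpoint argument.\<close>

lemma max_residual_opt_offset:
  assumes "finite D" "D \<noteq> {}"
  shows "max_residual D \<psi> A B i (opt_offset D \<psi> A B i) = min_fit_error D \<psi> A B i"
proof -
  let ?g = "\<lambda>(x, u, x'). \<psi> x' $ i - row i A \<bullet> \<psi> x - row i B \<bullet> u"
  have max_residual_eq: "max_residual D \<psi> A B i c = Max ((\<lambda>v. \<bar>v - c\<bar>) ` ?g ` D)" for c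
    by (simp add: max_residual_def image_image case_prod_unfold)
  obtain m where m: "\<And>c. max_residual D \<psi> A B i m \<le> max_residual D \<psi> A B i c"
    using ex_minimizer_Max_abs_diff[of "?g ` D"] assms unfolding max_residual_eq by auto
  have "max_residual D \<psi> A B i (opt_offset D \<psi> A B i) \<le> max_residual D \<psi> A B i c" for c
    unfolding opt_offset_def
    by (rule arg_minI[where x = m]) (auto simp: not_less intro: m)
  then show ?thesis
    unfolding min_fit_error_def by (intro Least_equality[symmetric]) auto
qed

lemma abs_residual_le_min_fit_error:
  assumes "finite D" "(x, u, x') \<in> D"
  shows "\<bar>\<psi> x' $ i - row i A \<bullet> \<psi> x - row i B \<bullet> u - opt_offset D \<psi> A B i\<bar>
    \<le> min_fit_error D \<psi> A B i"
proof -
  have "\<bar>\<psi> x' $ i - row i A \<bullet> \<psi> x - row i B \<bullet> u - opt_offset D \<psi> A B i\<bar>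
      \<le> max_residual D \<psi> A B i (opt_offset D \<psi> A B i)"
    unfolding max_residual_def using assms by (intro Max_ge) force+
  then show ?thesis
    using assms by (subst (asm) max_residual_opt_offset) auto
qed

lemma infnorm_lipschitz_const_lifted_error:
  assumes \<psi>: "infnorm_lipschitz_const L X \<psi>"
    and E: "infnorm_lipschitz_const K (X \<times> U) (lifted_error f \<psi> A B i)"
  shows "infnorm_lipschitz_const (norm1 (row i A - row i A') * L + norm1 (row i B - row i B') + K)
    (X \<times> U) (lifted_error f \<psi> A' B' i)"
    (is "infnorm_lipschitz_const ?C _ _")
  unfolding infnorm_lipschitz_const_def
proof (intro conjI ballI)
  show "0 \<le> ?C"
    using assms by (simp add: norm1_nonneg infnorm_lipschitz_const_nonneg)
next
  fix y z assume yz: "y \<in> X \<times> U" "z \<in> X \<times> U"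
  obtain x u x' u' where y: "y = (x, u)" and z: "z = (x', u')"
    by (cases y, cases z)
  let ?E = "lifted_error f \<psi> A B i" and ?E' = "lifted_error f \<psi> A' B' i"
  let ?a = "row i A - row i A'" and ?b = "row i B - row i B'" and ?d = "infnorm (y - z)"
  have d: "infnorm (x - x') \<le> ?d" "infnorm (u - u') \<le> ?d"
    by (simp_all add: y z infnorm_pair)
  have "infnorm (\<psi> x - \<psi> x') \<le> L * infnorm (x - x')"
    using yz by (intro infnorm_lipschitz_constD[OF \<psi>]) (auto simp: y z)
  also have "\<dots> \<le> L * ?d"
    by (intro mult_left_mono d infnorm_lipschitz_const_nonneg[OF \<psi>])
  finally have a: "\<bar>?a \<bullet> (\<psi> x - \<psi> x')\<bar> \<le> norm1 ?a * (L * ?d)"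
    by (meson abs_inner_le_norm1_infnorm mult_left_mono norm1_nonneg order_trans)
  have b: "\<bar>?b \<bullet> (u - u')\<bar> \<le> norm1 ?b * ?d"
    by (meson d(2) abs_inner_le_norm1_infnorm mult_left_mono norm1_nonneg order_trans)
  have e: "\<bar>?E y - ?E z\<bar> \<le> K * ?d"
    using infnorm_lipschitz_constD[OF E yz] by (simp add: infnorm_real)
  \<comment> \<open>The nonlinear term \<open>\<psi> (f (x, u)) $ i\<close> is common to
    \<open>?E\<close> and \<open>?E'\<close>, so it cancels and only the differences of the matrix
    rows remain.\<close>
  have "?E' y - ?E' z = ?a \<bullet> (\<psi> x - \<psi> x') + ?b \<bullet> (u - u') + (?E y - ?E z)"
    by (simp add: y z lifted_error_def inner_diff_left inner_diff_right)
  then have "\<bar>?E' y - ?E' z\<bar> \<le> norm1 ?a * (L * ?d) + norm1 ?b * ?d + K * ?d"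
    using a b e by linarith
  then show "infnorm (?E' y - ?E' z) \<le> ?C * ?d"
    by (simp add: infnorm_real algebra_simps)
qed

theorem theorem5:
  fixes X :: "(real ^ 'n) set" and U :: "(real ^ 'm) set"
    and f :: "(real ^ 'n) \<times> (real ^ 'm) \<Rightarrow> real ^ 'n"
    and S\<^sub>x :: "(real ^ 'n) set" and S\<^sub>u :: "(real ^ 'm) set"
    and S' :: "((real ^ 'n) \<times> (real ^ 'm)) set"
    and D D' :: "((real ^ 'n) \<times> (real ^ 'm) \<times> (real ^ 'n)) set"
    and b :: real
    and \<psi> :: "real ^ 'n \<Rightarrow> real ^ 'p"
    and A A' :: "real ^ 'p ^ 'p" and B B' :: "real ^ 'm ^ 'p"
    and L\<^sub>\<psi> :: real and L\<^sub>E :: "'p \<Rightarrow> real"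
    and \<epsilon> :: "'p \<Rightarrow> real" and c :: "real ^ 'p" and W :: "(real ^ 'p) set"
  assumes "f \<in> X \<times> U \<rightarrow> X"
    and "S\<^sub>x \<times> S\<^sub>u \<subseteq> X \<times> U"
    and "S' \<subseteq> S\<^sub>x \<times> S\<^sub>u" and "S' \<noteq> {}"
    and "data_set X U f D"
    and "dispersion (data_xu D) (S\<^sub>x \<times> S\<^sub>u) = ereal b"
    and "infnorm_lipschitz_const L\<^sub>\<psi> X \<psi>"
    and "\<And>i. infnorm_lipschitz_const (L\<^sub>E i) (X \<times> U) (lifted_error f \<psi> A B i)"
  defines "D' \<equiv> local_data S' b D"
  defines "\<epsilon> \<equiv> \<lambda>i. (norm1 (row i A - row i A') * L\<^sub>\<psi> + norm1 (row i B - row i B') + L\<^sub>E i) * b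
                     + min_fit_error D' \<psi> A' B' i"
  defines "c \<equiv> (\<chi> i. opt_offset D' \<psi> A' B' i)"
  defines "W \<equiv> c +o {w. \<forall>i. w $ i \<in> {- \<epsilon> i .. \<epsilon> i}}"
  shows "koopman_over_approximation X U f \<psi> A' B' W S'"
proof -
  define C where "C i = norm1 (row i A - row i A') * L\<^sub>\<psi> + norm1 (row i B - row i B') + L\<^sub>E i" for i
  have lip: "infnorm_lipschitz_const (C i) (X \<times> U) (lifted_error f \<psi> A' B' i)" for i
    unfolding C_def by (rule infnorm_lipschitz_const_lifted_error) fact+
  have fin: "finite D" "D \<noteq> {}"
    using \<open>data_set X U f D\<close> by (simp_all add: data_set_def)
  have fin_xu: "finite (data_xu D)" "data_xu D \<noteq> {}"
    using fin by (simp_all add: data_xu_def)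
  have "finite D'"
    unfolding D'_def local_data_def by (rule finite_subset[OF _ fin(1)]) auto
  show ?thesis
    unfolding koopman_over_approximation_def
  proof (intro conjI ballI)
    show "S' \<subseteq> X \<times> U"
      using assms(2,3) by blast
  next
    fix y assume "y \<in> S'"
    then have y: "y \<in> S\<^sub>x \<times> S\<^sub>u" "y \<in> X \<times> U"
      using assms(2,3) by auto
    obtain x u where xu: "y = (x, u)"
      by (cases y)
    obtain d where d: "d \<in> data_xu D" "infnorm (y - d) \<le> b"
      using dispersion_nearest[OF fin_xu assms(6) y(1)] .
    obtain x\<^sub>d u\<^sub>d where d_eq: "d = (x\<^sub>d, u\<^sub>d)"
      by (cases d)
    have data: "(x\<^sub>d, u\<^sub>d, f d) \<in> D" "d \<in> X \<times> U"
      using d(1) \<open>data_set X U f D\<close> by (auto simp: data_xu_def data_set_def d_eq)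
    \<comment> \<open>Writing \<open>d = y + (d - y)\<close> places the data point in the enlarged
      subdomain. The ball must be closed, as the distance may equal \<open>b\<close>.\<close>
    have "d - y \<in> infnorm_ball b"
      using d(2) by (simp add: infnorm_ball_def infnorm_sub)
    then have "d \<in> S' + infnorm_ball b"
      using set_plus_intro[OF \<open>y \<in> S'\<close>, of "d - y"] by simp
    \<comment> \<open>This also shows that \<open>D'\<close> is nonempty, so that the minimal fit
      error and its offset are meaningful.\<close>
    then have data': "(x\<^sub>d, u\<^sub>d, f d) \<in> D'"
      using data(1) d(1) by (simp add: D'_def local_data_def d_eq)
    have "\<bar>lifted_error f \<psi> A' B' i y - c $ i\<bar> \<le> \<epsilon> i" for i
    proof -
      let ?E = "lifted_error f \<psi> A' B' i"
      have "\<bar>?E y - ?E d\<bar> \<le> C i * infnorm (y - d)"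
        using infnorm_lipschitz_constD[OF lip y(2) data(2)] by (simp add: infnorm_real)
      also have "\<dots> \<le> C i * b"
        by (intro mult_left_mono d infnorm_lipschitz_const_nonneg[OF lip])
      finally have "\<bar>?E y - ?E d\<bar> \<le> C i * b" .
      \<comment> \<open>The successor state stored with \<open>d\<close> is \<open>f d\<close>, so
        the lifted error at \<open>d\<close> minus the offset is exactly the residual of a tuple in
        \<open>D'\<close>.\<close>
      moreover have "\<bar>?E d - c $ i\<bar> \<le> min_fit_error D' \<psi> A' B' i"
        using abs_residual_le_min_fit_error[OF \<open>finite D'\<close> data', of \<psi> i A' B']
        by (simp add: lifted_error_def c_def d_eq)
      ultimately show ?thesis
        unfolding \<epsilon>_def C_def[symmetric] by linarith
    qed
    then have "\<psi> (f (x, u)) - A' *v \<psi> x - B' *v u - c \<in> {w. \<forall>i. w $ i \<in> {- \<epsilon> i .. \<epsilon> i}}"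
      by (simp add: lifted_error_def xu matrix_vector_mul_component row_def abs_le_iff
          minus_le_iff[of "\<epsilon> _"])
    \<comment> \<open>The componentwise bounds describe a box centered at the origin; translating it
      by \<open>c\<close> gives \<open>W\<close>.\<close>
    then have "c + (\<psi> (f (x, u)) - A' *v \<psi> x - B' *v u - c) \<in> W"
      unfolding W_def by (rule set_plus_intro2)
    then show "case y of (x, u) \<Rightarrow> \<psi> (f (x, u)) - A' *v \<psi> x - B' *v u \<in> W"
      by (simp add: xu algebra_simps)
  qed
qed

end
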